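(* Let $s,t$ be positive integers and let $F$ be a gerechte framework of order $n = st$ in which every region is an $s \times t$ rectangle. Then $F$ is realizable.
   Context: A gerechte framework of order $n$ is a partition of the cells of an $n\times n$ array into $n$ regions, each containing $n$ cells. A latin square of order $n$ is an $n\times n$ array with symbols $1,\dots,n$ in which each symbol appears exactly once in each row and once in each column. A latin square realizes a gerechte framework if, when its cells are partitioned by the framework, each region contains each symbol exactly once; a framework with such a latin square is called realizable. A region is an $a\times b$ rectangle if it consists of the cells lying in some $a$ consecutive rows and some $b$ consecutive columns (height $a$, width $b$). *)

theory Defs
  imports Main "HOL-Library.Disjoint_Sets"
begin

(* Rows, columns and symbols are all indexed by {1..n}; the cell (i, j) lies in row i and column j. *)

type_synonym cell = "nat \<times> nat"

definition cells :: "nat \<Rightarrow> cell set" where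
  "cells n = {1..n} \<times> {1..n}"

definition gerechte_framework :: "nat \<Rightarrow> cell set set \<Rightarrow> bool" where
  "gerechte_framework n F \<longleftrightarrow>
     partition_on (cells n) F \<and> card F = n \<and> (\<forall>R\<in>F. card R = n)"

(* Arrays are total functions on cells; values outside cells n are irrelevant. *)
definition latin_square :: "nat \<Rightarrow> (cell \<Rightarrow> nat) \<Rightarrow> bool" where
  "latin_square n L \<longleftrightarrow>
     (\<forall>c\<in>cells n. L c \<in> {1..n}) \<and>
     (\<forall>i\<in>{1..n}. \<forall>k\<in>{1..n}. \<exists>!j. j \<in> {1..n} \<and> L (i, j) = k) \<and>
     (\<forall>j\<in>{1..n}. \<forall>k\<in>{1..n}. \<exists>!i. i \<in> {1..n} \<and> L (i, j) = k)"

definition realizes :: "nat \<Rightarrow> (cell \<Rightarrow> nat) \<Rightarrow> cell set set \<Rightarrow> bool" where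
  "realizes n L F \<longleftrightarrow> (\<forall>R\<in>F. \<forall>k\<in>{1..n}. \<exists>!c. c \<in> R \<and> L c = k)"

definition realizable :: "nat \<Rightarrow> cell set set \<Rightarrow> bool" where
  "realizable n F \<longleftrightarrow> (\<exists>L. latin_square n L \<and> realizes n L F)"

definition is_rectangle :: "nat \<Rightarrow> nat \<Rightarrow> cell set \<Rightarrow> bool" where
  "is_rectangle a b R \<longleftrightarrow> (\<exists>i j. R = {i..<i + a} \<times> {j..<j + b})"

end

(*
  The cell directly above the top left corner of a rectangle R lies in a rectangle that must end
  there, since otherwise it would meet R; by induction the height of every rectangle divides the
  offset of its top row, and likewise for columns.  Hence F is the standard grid of s by t boxes,
  and it is realized by a cyclic sudoku: in zero-based coordinates i = s a + b and j = t c + d,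
  the cell (i, j) receives the pair (b + c mod s, a + d mod t).
*)
theory Submission
  imports Defs
begin

text \<open>Corners are written \<open>Suc i\<close>, \<open>Suc j\<close> because it is the
  zero-based offsets \<open>i\<close>, \<open>j\<close> that turn out to be multiples of
  \<open>s\<close> and \<open>t\<close>.\<close>

lemma rectangle_tile_aligned:
  assumes P: "partition_on (cells n) F" and rect: "\<forall>R\<in>F. is_rectangle s t R"
    and st: "s > 0" "t > 0"
    and R: "{Suc i..<Suc i + s} \<times> {Suc j..<Suc j + t} \<in> F"
  shows "s dvd i \<and> t dvd j"
proof -
  have sub: "R \<subseteq> cells n" if "R \<in> F" for R
    using P that by (auto simp: partition_on_def)
  have cover: "\<exists>a b. {Suc a..<Suc a + s} \<times> {Suc b..<Suc b + t} \<in> F \<and>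
      (x, y) \<in> {Suc a..<Suc a + s} \<times> {Suc b..<Suc b + t}" if xy: "(x, y) \<in> cells n" for x y
  proof -
    obtain R' where R': "R' \<in> F" "(x, y) \<in> R'"
      using P xy unfolding partition_on_def by (metis UnionE)
    obtain a b where ab: "R' = {a..<a + s} \<times> {b..<b + t}"
      using rect R'(1) by (auto simp: is_rectangle_def)
    \<comment> \<open>As \<open>s\<close> and \<open>t\<close> are positive, a rectangle contains
      its own corner, whose coordinates are therefore at least 1.\<close>
    have "(a, b) \<in> cells n"
      using sub[OF R'(1)] ab st by auto
    then obtain a' b' where "a = Suc a'" "b = Suc b'"
      by (cases a; cases b) (auto simp: cells_def)
    with R' ab show ?thesis by blast
  qed
  have eq: "R1 = R2" if "R1 \<in> F" "R2 \<in> F" "p \<in> R1" "p \<in> R2" for R1 R2 p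
    using P that by (auto simp: partition_on_def disjoint_def)
  have corner_eq: "a = a' \<and> b = b'"
    if "{Suc a..<Suc a + s} \<times> {Suc b..<Suc b + t} = {Suc a'..<Suc a' + s} \<times> {Suc b'..<Suc b' + t}"
    for a b a' b'
    using that st by (auto simp: times_eq_iff atLeastLessThan_eq_iff)
  have rows: "s dvd i" if "{Suc i..<Suc i + s} \<times> {Suc j..<Suc j + t} \<in> F" for i j
    using that
  \<comment> \<open>The column stays general, since the rectangle above the corner may start in a
    different column.\<close>
  proof (induction i arbitrary: j rule: less_induct)
    case (less i)
    show ?case
    proof (cases "i = 0")
      case False
      have "(Suc i, Suc j) \<in> cells n"
        using sub[OF less.prems] st by auto
      then have "(i, Suc j) \<in> cells n"
        using False by (auto simp: cells_def)
      from cover[OF this] obtain a b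
        where ab: "{Suc a..<Suc a + s} \<times> {Suc b..<Suc b + t} \<in> F"
          "(i, Suc j) \<in> {Suc a..<Suc a + s} \<times> {Suc b..<Suc b + t}" by blast
      \<comment> \<open>If the upper rectangle went on past row \<open>i\<close>, it would share the
        cell \<open>(Suc i, Suc j)\<close> with the given one. The two would coincide, yet only the
        upper one reaches row \<open>i\<close>.\<close>
      have "i = a + s"
      proof (rule ccontr)
        assume "i \<noteq> a + s"
        with ab(2) have "(Suc i, Suc j) \<in> {Suc a..<Suc a + s} \<times> {Suc b..<Suc b + t}" by auto
        from corner_eq[OF eq[OF ab(1) less.prems this]] st ab(2) show False by auto
      qed
      moreover have "s dvd a"
        using less.IH[OF _ ab(1)] ab(2) by auto
      ultimately show ?thesis by simp
    qed simp
  qed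
  \<comment> \<open>The same argument with the cell to the left of the corner.\<close>
  have cols: "t dvd j" if "{Suc i..<Suc i + s} \<times> {Suc j..<Suc j + t} \<in> F" for i j
    using that
  proof (induction j arbitrary: i rule: less_induct)
    case (less j)
    show ?case
    proof (cases "j = 0")
      case False
      have "(Suc i, Suc j) \<in> cells n"
        using sub[OF less.prems] st by auto
      then have "(Suc i, j) \<in> cells n"
        using False by (auto simp: cells_def)
      from cover[OF this] obtain a b
        where ab: "{Suc a..<Suc a + s} \<times> {Suc b..<Suc b + t} \<in> F"
          "(Suc i, j) \<in> {Suc a..<Suc a + s} \<times> {Suc b..<Suc b + t}" by blast
      have "j = b + t"
      proof (rule ccontr)
        assume "j \<noteq> b + t"
        with ab(2) have "(Suc i, Suc j) \<in> {Suc a..<Suc a + s} \<times> {Suc b..<Suc b + t}" by auto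
        from corner_eq[OF eq[OF ab(1) less.prems this]] st ab(2) show False by auto
      qed
      moreover have "t dvd b"
        using less.IH[OF _ ab(1)] ab(2) by auto
      ultimately show ?thesis by simp
    qed simp
  qed
  from rows[OF R] cols[OF R] show ?thesis ..
qed

text \<open>The pair is encoded as a two-digit number with low digit in base \<open>t\<close>, and
  \<open>Suc\<close> shifts it to symbols starting at 1. Each \<open>- 1\<close> passes to
  zero-based coordinates.\<close>

definition sudoku :: "nat \<Rightarrow> nat \<Rightarrow> cell \<Rightarrow> nat" where
  "sudoku s t = (\<lambda>(i, j).
     Suc (t * (((i - 1) mod s + (j - 1) div t) mod s) + ((i - 1) div s + (j - 1) mod t) mod t))"

lemma sudoku_range:
  assumes "s > 0" "t > 0"
  shows "sudoku s t c \<in> {1..s * t}"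
proof -
  obtain i j where c: "c = (i, j)" by (cases c)
  define x y where "x = ((i - 1) mod s + (j - 1) div t) mod s"
    and "y = ((i - 1) div s + (j - 1) mod t) mod t"
  have "x < s" "y < t"
    using assms by (auto simp: x_def y_def)
  \<comment> \<open>Since \<open>x < s\<close>, the whole block of \<open>t\<close> values with
    leading digit \<open>x\<close> fits below \<open>t * s\<close>.\<close>
  then have "t * x + t \<le> t * s"
    using mult_le_mono2[of "Suc x" s t] by simp
  moreover have "sudoku s t c = Suc (t * x + y)"
    by (simp add: sudoku_def c x_def y_def)
  ultimately show ?thesis
    using \<open>y < t\<close> by (simp add: mult.commute)
qed

text \<open>Division with remainder by \<open>t\<close> recovers both digits, because the low one is
  below \<open>t\<close>.\<close>

lemma sudoku_eqD:
  assumes "t > 0" and "sudoku s t (i, j) = sudoku s t (i', j')"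
  shows "((i - 1) mod s + (j - 1) div t) mod s = ((i' - 1) mod s + (j' - 1) div t) mod s"
    and "((i - 1) div s + (j - 1) mod t) mod t = ((i' - 1) div s + (j' - 1) mod t) mod t"
proof -
  have *: "x = x' \<and> y = y'" if "t * x + y = t * x' + y'" "y < t" "y' < t" for x y x' y'
  proof -
    have "x = (t * x + y) div t" "y = (t * x + y) mod t"
      "x' = (t * x' + y') div t" "y' = (t * x' + y') mod t"
      using that(2,3) by simp_all
    with that(1) show ?thesis by metis
  qed
  have eq: "t * (((i - 1) mod s + (j - 1) div t) mod s) + ((i - 1) div s + (j - 1) mod t) mod t =
      t * (((i' - 1) mod s + (j' - 1) div t) mod s) + ((i' - 1) div s + (j' - 1) mod t) mod t"
    using assms(2) by (simp add: sudoku_def)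
  show "((i - 1) mod s + (j - 1) div t) mod s = ((i' - 1) mod s + (j' - 1) div t) mod s"
    "((i - 1) div s + (j - 1) mod t) mod t = ((i' - 1) div s + (j' - 1) mod t) mod t"
    using *[OF eq] assms(1) by simp_all
qed

lemma add_mod_cancel_nat:
  fixes m :: nat
  assumes "(a + c) mod m = (b + c) mod m" "a < m" "b < m"
  shows "a = b"
proof -
  \<comment> \<open>Over the integers \<open>c\<close> can be subtracted without truncation.\<close>
  have "(int a + int c) mod int m = (int b + int c) mod int m"
    using assms(1) by (metis of_nat_add of_nat_mod)
  then have "int a mod int m = int b mod int m"
    using mod_diff_cong[of "int a + int c" "int m" "int b + int c" "int c" "int c"] by simp
  with assms show ?thesis by (simp flip: of_nat_mod)
qed

text \<open>The lower bounds matter: 0 and 1 have the same truncated predecessor.\<close>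

lemma eq_of_div_mod_pred:
  assumes "(i - 1) div s = (i' - 1) div s" "(i - 1) mod s = (i' - 1) mod s" "i \<ge> 1" "i' \<ge> (1::nat)"
  shows "i = i'"
proof -
  have "i - 1 = i' - 1"
    using assms(1,2) by (metis div_mult_mod_eq)
  with assms(3,4) show ?thesis by simp
qed

text \<open>Along a row, the first digit is a translate mod \<open>s\<close> of the block index of
  the column, and the second a translate mod \<open>t\<close> of the position within that
  block.\<close>

lemma inj_on_sudoku_row:
  assumes "t > 0"
  shows "inj_on (\<lambda>j. sudoku s t (i, j)) {1..s * t}"
proof (rule inj_onI)
  fix j j' assume j: "j \<in> {1..s * t}" "j' \<in> {1..s * t}"
    and eq: "sudoku s t (i, j) = sudoku s t (i, j')"
  \<comment> \<open>There are only \<open>s\<close> blocks of columns, so the block index is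
    determined by its residue mod \<open>s\<close>.\<close>
  have "(j - 1) div t < s" "(j' - 1) div t < s"
    using j by (auto intro!: less_mult_imp_div_less)
  then have "(j - 1) div t = (j' - 1) div t"
    using sudoku_eqD(1)[OF assms eq] \<open>(j - 1) div t < s\<close> \<open>(j' - 1) div t < s\<close>
    by - (rule add_mod_cancel_nat[where c = "(i - 1) mod s" and m = s]; simp add: add.commute)
  moreover have "(j - 1) mod t = (j' - 1) mod t"
    using sudoku_eqD(2)[OF assms eq] assms
    by - (rule add_mod_cancel_nat[where c = "(i - 1) div s" and m = t]; simp add: add.commute)
  ultimately show "j = j'"
    using j eq_of_div_mod_pred[of j t j'] by simp
qed

text \<open>Here the digits swap roles: the second fixes which of the \<open>t\<close> bands of rows
  is meant, the first the position inside the band.\<close>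

lemma inj_on_sudoku_column:
  assumes "s > 0" "t > 0"
  shows "inj_on (\<lambda>i. sudoku s t (i, j)) {1..s * t}"
proof (rule inj_onI)
  fix i i' assume i: "i \<in> {1..s * t}" "i' \<in> {1..s * t}"
    and eq: "sudoku s t (i, j) = sudoku s t (i', j)"
  have "(i - 1) div s < t" "(i' - 1) div s < t"
    using i by (auto intro!: less_mult_imp_div_less simp: mult.commute)
  then have "(i - 1) div s = (i' - 1) div s"
    using sudoku_eqD(2)[OF assms(2) eq] \<open>(i - 1) div s < t\<close> \<open>(i' - 1) div s < t\<close>
    by - (rule add_mod_cancel_nat[where c = "(j - 1) mod t" and m = t]; simp)
  moreover have "(i - 1) mod s = (i' - 1) mod s"
    using sudoku_eqD(1)[OF assms(2) eq] assms
    by - (rule add_mod_cancel_nat[where c = "(j - 1) div t" and m = s]; simp)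
  ultimately show "i = i'"
    using i eq_of_div_mod_pred[of i s i'] by simp
qed

text \<open>Inside a box both block indices are constant, so the first digit determines the row
  offset and the second the column offset.\<close>

lemma inj_on_sudoku_box:
  assumes "s > 0" "t > 0"
  shows "inj_on (sudoku s t) ({Suc (s * a)..<Suc (s * a) + s} \<times> {Suc (t * b)..<Suc (t * b) + t})"
proof (rule inj_onI, clarify)
  fix i j i' j'
  assume i: "i \<in> {Suc (s * a)..<Suc (s * a) + s}" "i' \<in> {Suc (s * a)..<Suc (s * a) + s}"
    and j: "j \<in> {Suc (t * b)..<Suc (t * b) + t}" "j' \<in> {Suc (t * b)..<Suc (t * b) + t}"
    and eq: "sudoku s t (i, j) = sudoku s t (i', j')"
  have divs: "(k - 1) div m = c" if "k \<in> {Suc (m * c)..<Suc (m * c) + m}" for k m c :: nat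
    using that by (intro div_nat_eqI) (auto simp: algebra_simps)
  have "(i - 1) mod s = (i' - 1) mod s"
    using sudoku_eqD(1)[OF assms(2) eq] assms divs[OF j(1)] divs[OF j(2)]
    by - (rule add_mod_cancel_nat[where c = b and m = s]; simp)
  moreover have "(j - 1) mod t = (j' - 1) mod t"
    using sudoku_eqD(2)[OF assms(2) eq] assms divs[OF i(1)] divs[OF i(2)]
    by - (rule add_mod_cancel_nat[where c = a and m = t]; simp add: add.commute)
  ultimately show "i = i' \<and> j = j'"
    using i j divs[OF i(1)] divs[OF i(2)] divs[OF j(1)] divs[OF j(2)]
      eq_of_div_mod_pred[of i s i'] eq_of_div_mod_pred[of j t j'] by auto
qed

text \<open>An injection into a finite set of equal size is onto. This turns injectivity on rows,
  columns and regions into the "exactly once" conditions.\<close>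

lemma ex1_preimage_of_inj_on_card:
  assumes "inj_on f A" "f ` A \<subseteq> B" "finite B" "card A = card B" "k \<in> B"
  shows "\<exists>!x. x \<in> A \<and> f x = k"
proof -
  have "f ` A = B"
    using assms by (intro card_subset_eq) (auto simp: card_image)
  with assms show ?thesis
    by (auto simp: inj_on_def)
qed

theorem theorem5:
  fixes s t n :: nat and F :: "cell set set"
  assumes "s > 0" and "t > 0" and "n = s * t"
    and "gerechte_framework n F"
    and "\<forall>R\<in>F. is_rectangle s t R"
  shows "realizable n F"
proof -
  have P: "partition_on (cells n) F" and card: "\<forall>R\<in>F. card R = n"
    using assms(4) by (auto simp: gerechte_framework_def)
  have range: "sudoku s t c \<in> {1..n}" for c
    using sudoku_range assms by blast
  have "latin_square n (sudoku s t)"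
    unfolding latin_square_def
  proof (intro conjI ballI)
    fix i k assume k: "k \<in> {1..n}"
    show "\<exists>!j. j \<in> {1..n} \<and> sudoku s t (i, j) = k"
      using inj_on_sudoku_row[of t s i] assms range k
      by (intro ex1_preimage_of_inj_on_card[where B = "{1..n}"]) blast+
  next
    fix j k assume k: "k \<in> {1..n}"
    show "\<exists>!i. i \<in> {1..n} \<and> sudoku s t (i, j) = k"
      using inj_on_sudoku_column[of s t j] assms range k
      by (intro ex1_preimage_of_inj_on_card[where B = "{1..n}"]) blast+
  qed (rule range)
  moreover have "realizes n (sudoku s t) F"
    unfolding realizes_def
  proof (intro ballI)
    fix R k assume R: "R \<in> F" and k: "k \<in> {1..n}"
    obtain i j where ij: "R = {i..<i + s} \<times> {j..<j + t}"
      using R assms(5) by (auto simp: is_rectangle_def)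
    have "(i, j) \<in> R" "R \<subseteq> cells n"
      using P R ij assms(1,2) by (auto simp: partition_on_def)
    then have "(i, j) \<in> cells n" by blast
    then obtain i' j' where Suc: "i = Suc i'" "j = Suc j'"
      by (cases i; cases j) (auto simp: cells_def)
    have "s dvd i' \<and> t dvd j'"
      using rectangle_tile_aligned[OF P assms(5,1,2)] R ij Suc by blast
    then obtain a b where "i' = s * a" "j' = t * b"
      by (auto simp: dvd_def)
    then have "inj_on (sudoku s t) R"
      using inj_on_sudoku_box[OF assms(1,2)] ij Suc by simp
    then show "\<exists>!c. c \<in> R \<and> sudoku s t c = k"
      using card R range k
      by (intro ex1_preimage_of_inj_on_card[where B = "{1..n}"]) auto
  qed
  ultimately show ?thesis
    by (auto simp: realizable_def)
qed

end
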